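(* Let $(\xi_k)$ be a sequence of iterates of the globalized inexact semismooth Newton method described in the context, with search directions $(d_k)$. Then $\xi_k\to\bar\xi$ (strongly) in $Y$, where $\bar\xi$ is the unique solution of $\nabla\Phi(\bar\xi)=0$. In addition, $d_k\to0$ in $Y$.
   Context: Setting. $U,Y$ are real Hilbert spaces, $S:U\to Y$ is a bounded linear operator with Hilbert space adjoint $S^*$, $z\in Y$, $\alpha>0$, and $g:U\to\mathbb R\cup\{+\infty\}$ is proper, convex, lower semicontinuous with $g(0)<+\infty$. For a proper convex lower semicontinuous function $h$ on a Hilbert space $X$, $\operatorname{env}_h(\zeta):=\min_{x\in X}\frac12\|x-\zeta\|_X^2+h(x)$ and $\operatorname{prox}_h(\zeta)$ is the unique minimizer. Define $\Psi,\Phi:Y\to\mathbb R$ by $$\Psi(\xi)=\frac1{2\alpha}\|S^*\xi\|_U^2-\alpha\operatorname{env}_{g/\alpha}(S^*\xi/\alpha),\qquad \Phi(\xi)=\frac12\|\xi-z\|_Y^2-\frac12\|z\|_Y^2+\Psi(\xi).$$ Both are continuously differentiable, with gradients $\nabla\Psi(\xi)=S\operatorname{prox}_{g/\alpha}(S^*\xi/\alpha)$ and $\nabla\Phi(\xi)=\xi-z+S\operatorname{prox}_{g/\alpha}(S^*\xi/\alpha)$. The equation $\nabla\Phi(\xi)=0$ has a unique solution. Second-order semismoothness. Let $\mathcal L(Y,Y)$ be the space of bounded linear operators on $Y$. A continuously differentiable $T:Y\to\mathbb R$ is second-order semismooth with respect to a set-valued map $\partial^2T:Y\rightrightarrows\mathcal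 L(Y,Y)$ with non-empty images if for every $y\in Y$, as $\|h\|_Y\to0$, $\sup_{M\in\partial^2T(y+h)}|T(y+h)-T(y)-T'(y)h-\frac12\langle Mh,h\rangle|=o(\|h\|_Y^2)$ and $\sup_{M\in\partial^2T(y+h)}\|\nabla T(y+h)-\nabla T(y)-Mh\|_Y=o(\|h\|_Y)$. Standing assumption. Let $\mathcal B:=\{M\in\mathcal L(Y,Y): M=M^*,\ \langle My,y\rangle\ge0\ \forall y\in Y\}$. There is a set-valued map $\partial^2\Psi:Y\rightrightarrows\mathcal B$ such that $\Psi$ is second-order semismooth with respect to $\partial^2\Psi$, and there is $c>0$ with $\|M\|_{\mathcal L(Y,Y)}\le c$ for all $y\in Y$, $M\in\partial^2\Psi(y)$. Set $\partial^2\Phi(y):=I+\partial^2\Psi(y)$. Algorithm (globalized inexact semismooth Newton method). Parameters: $\sigma\in(0,1/2)$, $\beta\in(0,1)$, $\eta\ge0$, $\tau\in(0,1]$. Choose $\xi_0\in Y$. For $k=0,1,2,\dots$: choose $M_k\in\partial^2\Phi(\xi_k)$; compute $d_k\in Y$ with $\|M_kd_k+\nabla\Phi(\xi_k)\|_Y\le\eta\|\nabla\Phi(\xi_k)\|_Y^{1+\tau}$ by the conjugate gradient (CG) method below applied to $M_kd=-\nabla\Phi(\xi_k)$ with tolerance $\delta_{CG}:=\eta\|\nabla\Phi(\xi_k)\|_Y^{1+\tau}$; compute the smallest $l_k\in\{0,1,2,\dots\}$ with $\Phi(\xi_k+\beta^{l_k}d_k)-\Phi(\xi_k)\le\sigma\beta^{l_k}\langle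 d_k,\nabla\Phi(\xi_k)\rangle$; set $t_k:=\beta^{l_k}$, $\xi_{k+1}:=\xi_k+t_kd_k$. It is assumed that the algorithm performs infinitely many steps, with $\nabla\Phi(\xi_k)\ne0$ for all $k$, and generates a sequence of iterates $(\xi_k)$. CG method for $Ax=b$. Input: tolerance $\delta_{CG}>0$. Set $x_0=0$, $r_0=b$, $p_0=r_0$, $j=0$. While $\|r_j\|>\delta_{CG}$: $\alpha_j=\|r_j\|^2/\langle Ap_j,p_j\rangle$, $x_{j+1}=x_j+\alpha_jp_j$, $r_{j+1}=r_j-\alpha_jAp_j$, $\beta_j=\|r_{j+1}\|^2/\|r_j\|^2$, $p_{j+1}=r_{j+1}+\beta_jp_j$, $j:=j+1$. The current $x_j$ is returned when the loop ends. (The scalars $\alpha_j,\beta_j$ are local to the CG method.)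
   Formalization: Adds the hypothesis that all search directions d_k are nonzero: if η‖∇Φ(ξ_k)‖^τ ≥ 1, CG stops at once with d_k = 0 and the iterates stall at a non-solution (e.g. g=0, S=0, ξ_0=0, z≠0, η ≥ ‖z‖^{-τ}), so the claim as written fails. *)

theory Defs
  imports "HOL-Analysis.Analysis"
begin

definition proper :: "('a \<Rightarrow> ereal) \<Rightarrow> bool" where
  "proper h \<longleftrightarrow> (\<forall>x. h x \<noteq> -\<infinity>) \<and> (\<exists>x. h x \<noteq> \<infinity>)"

(* In ereal, 0 * \<infinity> = 0, so the end points t = 0 and t = 1 impose no condition even where
   h is infinite. *)
definition convex_ereal :: "('a::real_vector \<Rightarrow> ereal) \<Rightarrow> bool" where
  "convex_ereal h \<longleftrightarrow>
     (\<forall>x y. \<forall>t\<in>{0..1}.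
        h ((1 - t) *\<^sub>R x + t *\<^sub>R y) \<le> ereal (1 - t) * h x + ereal t * h y)"

definition lsc :: "('a::topological_space \<Rightarrow> ereal) \<Rightarrow> bool" where
  "lsc h \<longleftrightarrow> (\<forall>x. h x \<le> Liminf (nhds x) h)"

(* For proper, convex and lower semicontinuous h the infimum is an attained, finite minimum. *)
definition env :: "('a::real_inner \<Rightarrow> ereal) \<Rightarrow> 'a \<Rightarrow> real" where
  "env h \<zeta> = real_of_ereal (INF x. ereal ((norm (x - \<zeta>))\<^sup>2 / 2) + h x)"

definition Psi :: "('u::real_inner \<Rightarrow>\<^sub>L 'y::real_inner) \<Rightarrow> ('u \<Rightarrow> ereal) \<Rightarrow> real \<Rightarrow> 'y \<Rightarrow> real" where
  "Psi S g \<alpha> \<xi> =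
     (norm (adjoint (blinfun_apply S) \<xi>))\<^sup>2 / (2 * \<alpha>)
       - \<alpha> * env (\<lambda>x. g x / ereal \<alpha>) (adjoint (blinfun_apply S) \<xi> /\<^sub>R \<alpha>)"

definition Phi ::
  "('u::real_inner \<Rightarrow>\<^sub>L 'y::real_inner) \<Rightarrow> 'y \<Rightarrow> ('u \<Rightarrow> ereal) \<Rightarrow> real \<Rightarrow> 'y \<Rightarrow> real" where
  "Phi S z g \<alpha> \<xi> = (norm (\<xi> - z))\<^sup>2 / 2 - (norm z)\<^sup>2 / 2 + Psi S g \<alpha> \<xi>"

definition grad :: "('a::real_inner \<Rightarrow> real) \<Rightarrow> 'a \<Rightarrow> 'a" where
  "grad f x = (THE D. GDERIV f x :> D)"

definition continuously_differentiable :: "('a::real_inner \<Rightarrow> real) \<Rightarrow> bool" where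
  "continuously_differentiable f \<longleftrightarrow>
     (\<forall>x. \<exists>D. GDERIV f x :> D) \<and> continuous_on UNIV (grad f)"

(* The suprema over D (y + h) may be infinite away from h = 0, hence they are taken in ereal. *)
definition second_order_semismooth ::
  "('a::real_inner \<Rightarrow> real) \<Rightarrow> ('a \<Rightarrow> ('a \<Rightarrow>\<^sub>L 'a) set) \<Rightarrow> bool" where
  "second_order_semismooth T D \<longleftrightarrow>
     continuously_differentiable T \<and> (\<forall>y. D y \<noteq> {}) \<and>
     (\<forall>y. \<forall>\<epsilon>>0.
        (\<forall>\<^sub>F h in at 0.
           (SUP M\<in>D (y + h).
              ereal \<bar>T (y + h) - T y - frechet_derivative T (at y) h
                      - (blinfun_apply M h \<bullet> h) / 2\<bar>) \<le> ereal (\<epsilon> * (norm h)\<^sup>2)) \<and>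
        (\<forall>\<^sub>F h in at 0.
           (SUP M\<in>D (y + h).
              ereal (norm (grad T (y + h) - grad T y - blinfun_apply M h)))
             \<le> ereal (\<epsilon> * norm h)))"

definition psd_operators :: "('a::real_inner \<Rightarrow>\<^sub>L 'a) set" where
  "psd_operators =
     {M. blinfun_apply M = adjoint (blinfun_apply M) \<and> (\<forall>y. 0 \<le> blinfun_apply M y \<bullet> y)}"

definition hessian_Phi ::
  "('a::real_inner \<Rightarrow> ('a \<Rightarrow>\<^sub>L 'a) set) \<Rightarrow> 'a \<Rightarrow> ('a \<Rightarrow>\<^sub>L 'a) set" where
  "hessian_Phi D y = (\<lambda>M. id_blinfun + M) ` D y"

(* The triple (x_j, r_j, p_j) of the conjugate gradient method for A x = b, without stopping test. *)
primrec cg_state :: "('a::real_inner \<Rightarrow>\<^sub>L 'a) \<Rightarrow> 'a \<Rightarrow> nat \<Rightarrow> 'a \<times> 'a \<times> 'a" where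
  "cg_state A b 0 = (0, b, b)"
| "cg_state A b (Suc j) =
     (let (x, r, p) = cg_state A b j;
          a = (norm r)\<^sup>2 / (blinfun_apply A p \<bullet> p);
          x' = x + a *\<^sub>R p;
          r' = r - a *\<^sub>R blinfun_apply A p;
          c = (norm r')\<^sup>2 / (norm r)\<^sup>2
      in (x', r', r' + c *\<^sub>R p))"

definition cg_iterate :: "('a::real_inner \<Rightarrow>\<^sub>L 'a) \<Rightarrow> 'a \<Rightarrow> nat \<Rightarrow> 'a" where
  "cg_iterate A b j = fst (cg_state A b j)"

definition cg_residual :: "('a::real_inner \<Rightarrow>\<^sub>L 'a) \<Rightarrow> 'a \<Rightarrow> nat \<Rightarrow> 'a" where
  "cg_residual A b j = fst (snd (cg_state A b j))"

(* The method terminates and returns x. If norm b \<le> \<delta>, it stops at once and returns 0; a Newton step with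
   this search direction leaves the iterate unchanged, and so do all later ones. *)
definition cg_returns :: "('a::real_inner \<Rightarrow>\<^sub>L 'a) \<Rightarrow> 'a \<Rightarrow> real \<Rightarrow> 'a \<Rightarrow> bool" where
  "cg_returns A b \<delta> x \<longleftrightarrow>
     (\<exists>j. (\<forall>i<j. norm (cg_residual A b i) > \<delta>) \<and> norm (cg_residual A b j) \<le> \<delta> \<and>
          x = cg_iterate A b j)"

definition armijo :: "('a::real_inner \<Rightarrow> real) \<Rightarrow> real \<Rightarrow> real \<Rightarrow> 'a \<Rightarrow> 'a \<Rightarrow> nat \<Rightarrow> bool" where
  "armijo F \<sigma> \<beta> \<xi> d l \<longleftrightarrow>
     F (\<xi> + \<beta> ^ l *\<^sub>R d) - F \<xi> \<le> \<sigma> * \<beta> ^ l * (d \<bullet> grad F \<xi>)"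

(* An infinite run of the globalized inexact semismooth Newton method for F with generalized
   Hessian H, iterates \<xi> and search directions d; inner CG solves and line searches terminate. *)
definition newton_run ::
  "('a::real_inner \<Rightarrow> real) \<Rightarrow> ('a \<Rightarrow> ('a \<Rightarrow>\<^sub>L 'a) set) \<Rightarrow> real \<Rightarrow> real \<Rightarrow> real \<Rightarrow> real \<Rightarrow>
     (nat \<Rightarrow> 'a) \<Rightarrow> (nat \<Rightarrow> 'a) \<Rightarrow> bool" where
  "newton_run F H \<sigma> \<beta> \<eta> \<tau> \<xi> d \<longleftrightarrow>
     (\<forall>k. grad F (\<xi> k) \<noteq> 0 \<and>
        (\<exists>M\<in>H (\<xi> k). \<exists>l.
           norm (blinfun_apply M (d k) + grad F (\<xi> k)) \<le> \<eta> * norm (grad F (\<xi> k)) powr (1 + \<tau>) \<and>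
           cg_returns M (- grad F (\<xi> k)) (\<eta> * norm (grad F (\<xi> k)) powr (1 + \<tau>)) (d k) \<and>
           armijo F \<sigma> \<beta> (\<xi> k) (d k) l \<and> (\<forall>l'<l. \<not> armijo F \<sigma> \<beta> (\<xi> k) (d k) l') \<and>
           \<xi> (Suc k) = \<xi> k + \<beta> ^ l *\<^sub>R d k))"

end

theory Submission
  imports Defs
begin

text \<open>
  Since
  $\nabla\Psi(y+h)-\nabla\Psi(y)=Mh+o(\|h\|)$ with $\|M\|\le c$ and $\langle Mh,h\rangle\ge0$, a
  subdivision argument on segments makes $\nabla\Psi$ globally $c$-Lipschitz and monotone, so
  $\nabla\Phi$ is $(1+c)$-Lipschitz and strongly monotone with constant 1. A CG iterate $d$ for
  $Md=b$ satisfies the Galerkin identity $\langle b,d\rangle=\langle Md,d\rangle\ge\|d\|^2$, and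
  $\langle b,d\rangle$ increases with the CG steps, so it is at least its value
  $\|b\|^4/\langle Mb,b\rangle\ge\|b\|^2/(1+c)$ after the first one. With
  $b=-\nabla\Phi(\xi_k)$ the first bound keeps the Armijo step lengths away from 0. As
  $\Phi$ is bounded below, $\langle\nabla\Phi(\xi_k),d_k\rangle\to0$, hence $d_k\to0$ and
  $\nabla\Phi(\xi_k)\to0$, and strong monotonicity turns the latter into convergence of $\xi_k$.
\<close>

section \<open>Adjoints in Hilbert spaces\<close>

text \<open>The representer is the minimizer of the strictly convex functional \<open>J\<close>. A
  minimizing sequence is Cauchy by the parallelogram law, and the first-order condition at its limit
  reads \<open>f x = x \<bullet> w\<close>.\<close>

theorem Riesz_representation:
  fixes f :: "'a::{real_inner, complete_space} \<Rightarrow> real"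
  assumes "bounded_linear f"
  shows "\<exists>w. \<forall>x. f x = x \<bullet> w"
proof -
  interpret f: bounded_linear f by fact
  define J where "J x = (norm x)\<^sup>2 / 2 - f x" for x
  obtain K where K: "\<And>x. norm (f x) \<le> norm x * K" using f.bounded by blast
  have lower: "- K\<^sup>2 / 2 \<le> J x" for x
  proof -
    have "f x \<le> norm x * K" using K[of x] by simp
    moreover have "0 \<le> (norm x - K)\<^sup>2" by simp
    ultimately show ?thesis unfolding J_def by (simp add: power2_diff algebra_simps)
  qed
  define m where "m = (INF x. J x)"
  have bdd: "bdd_below (range J)" using lower by (intro bdd_belowI2)
  have m_le: "m \<le> J x" for x unfolding m_def by (rule cINF_lower[OF bdd]) simp
  have "\<exists>x. J x < m + 1 / Suc n" for n
    using cINF_less_iff[OF _ bdd, of "m + 1 / Suc n"] unfolding m_def by simp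
  then obtain X where X: "\<And>n. J (X n) < m + 1 / Suc n" by metis
  \<comment> \<open>Parallelogram law: the linear part of \<open>J\<close> cancels, and the midpoint
    value is at least the infimum \<open>m\<close>.\<close>
  have par: "(norm (x - y))\<^sup>2 \<le> 4 * (J x + J y - 2 * m)" for x y
  proof -
    have "J x + J y - 2 * J ((1/2) *\<^sub>R (x + y)) = (norm (x - y))\<^sup>2 / 4"
      unfolding J_def
      by (simp add: f.add f.scaleR power2_norm_eq_inner inner_add inner_diff
          inner_commute field_simps)
    with m_le[of "(1/2) *\<^sub>R (x + y)"] show ?thesis by simp
  qed
  have "Cauchy X"
  proof (rule metric_CauchyI)
    fix e :: real assume "e > 0"
    \<comment> \<open>Beyond \<open>N\<close> each of the two excesses over \<open>m\<close> is
      below \<open>e\<^sup>2 / 8\<close>; the factor 4 in \<open>par\<close> then gives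
      \<open>e\<^sup>2\<close>.\<close>
    then obtain N where N: "1 / Suc N < e\<^sup>2 / 8"
      using reals_Archimedean[of "e\<^sup>2 / 8"] by (auto simp: inverse_eq_divide)
    have "dist (X a) (X b) < e" if "a \<ge> N" "b \<ge> N" for a b
    proof -
      have le: "1 / Suc i \<le> 1 / Suc N" if "i \<ge> N" for i
        using that by (simp add: frac_le)
      have "(norm (X a - X b))\<^sup>2 \<le> 4 * (J (X a) + J (X b) - 2 * m)" by (rule par)
      also have "\<dots> < e\<^sup>2"
        using X[of a] X[of b] le[OF that(1)] le[OF that(2)] N by argo
      finally show ?thesis
        using \<open>e > 0\<close> by (simp add: dist_norm power2_less_imp_less)
    qed
    then show "\<exists>M. \<forall>a\<ge>M. \<forall>b\<ge>M. dist (X a) (X b) < e" by blast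
  qed
  then obtain w where w: "X \<longlonglongrightarrow> w" using Cauchy_convergent convergent_def by blast
  have "(\<lambda>n. J (X n)) \<longlonglongrightarrow> J w"
    unfolding J_def by (intro tendsto_intros f.tendsto w) simp
  moreover have "(\<lambda>n. m + 1 / Suc n) \<longlonglongrightarrow> m + 0"
    by (intro tendsto_intros LIMSEQ_Suc[OF lim_1_over_n])
  ultimately have "J w \<le> m + 0"
    by (rule LIMSEQ_le) (use X less_imp_le in blast)
  then have min: "J w \<le> J x" for x using m_le[of x] by simp
  have "f x = x \<bullet> w" for x
  proof -
    define q where "q = x \<bullet> w - f x"
    \<comment> \<open>The added 1 keeps \<open>N\<close> positive for \<open>x = 0\<close>;
      \<open>t = - q / N\<close> minimizes \<open>t * q + t\<^sup>2 * N / 2\<close>, with value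
      \<open>- q\<^sup>2 / (2 * N)\<close>.\<close>
    define N where "N = (norm x)\<^sup>2 + 1"
    have "N > 0" unfolding N_def by (simp add: add_nonneg_pos)
    define t where "t = - q / N"
    have "(norm (w + t *\<^sub>R x))\<^sup>2 = (norm w)\<^sup>2 + 2 * t * (x \<bullet> w) + t * t * (norm x)\<^sup>2"
      by (simp add: power2_norm_eq_inner inner_add inner_commute algebra_simps)
    then have "J (w + t *\<^sub>R x) = J w + t * q + t\<^sup>2 * (norm x)\<^sup>2 / 2"
      unfolding J_def q_def by (simp add: f.add f.scaleR field_simps power2_eq_square)
    with min[of "w + t *\<^sub>R x"] have "0 \<le> t * q + t\<^sup>2 * (norm x)\<^sup>2 / 2" by simp
    also have "\<dots> \<le> t * q + t\<^sup>2 * N / 2" unfolding N_def by (simp add: mult_left_mono)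
    also have "\<dots> = - q\<^sup>2 / (2 * N)"
      unfolding t_def using \<open>N > 0\<close> by (simp add: field_simps power2_eq_square)
    finally have "q\<^sup>2 \<le> 0" using \<open>N > 0\<close> by (simp add: field_simps)
    then show ?thesis unfolding q_def by simp
  qed
  then show ?thesis by blast
qed

text \<open>\<open>adjoint\<close> is a choice term, so its defining identity requires existence of
  an adjoint; Riesz representation in the complete domain supplies it.\<close>

lemma adjoint_blinfun_works:
  fixes A :: "'a::{real_inner, complete_space} \<Rightarrow>\<^sub>L 'b::real_inner"
  shows "blinfun_apply A x \<bullet> y = x \<bullet> adjoint (blinfun_apply A) y"
proof -
  have "\<exists>w. \<forall>x. blinfun_apply A x \<bullet> y = x \<bullet> w" for y
    by (rule Riesz_representation)
      (intro bounded_linear_compose[OF bounded_linear_inner_left] blinfun.bounded_linear_right)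
  then have "\<exists>B. \<forall>x y. blinfun_apply A x \<bullet> y = x \<bullet> B y" by metis
  then show ?thesis unfolding adjoint_def by (rule someI2_ex) blast
qed

lemma psd_operators_symmetric:
  fixes M :: "'a::{real_inner, complete_space} \<Rightarrow>\<^sub>L 'a"
  assumes "M \<in> psd_operators"
  shows "blinfun_apply M x \<bullet> y = x \<bullet> blinfun_apply M y"
  using assms adjoint_blinfun_works[of M x y] unfolding psd_operators_def by simp

section \<open>The conjugate gradient method\<close>

text \<open>
  Since $x/0=0$, the recursion is stationary with $r=p=0$ once the residual vanishes, so the
  CG invariants hold for every step index.
\<close>

locale cg =
  fixes A :: "'a::real_inner \<Rightarrow>\<^sub>L 'a" and b :: 'a
  assumes sym: "blinfun_apply A x \<bullet> y = x \<bullet> blinfun_apply A y"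
    and coercive: "(norm x)\<^sup>2 \<le> blinfun_apply A x \<bullet> x"
begin

abbreviation "x j \<equiv> cg_iterate A b j"
abbreviation "r j \<equiv> cg_residual A b j"

text \<open>Search direction of step j, followed by the CG scalars alpha_j and beta_j.\<close>

definition "p j = snd (snd (cg_state A b j))"
definition "a j = (norm (r j))\<^sup>2 / (A (p j) \<bullet> p j)"
definition "c j = (norm (r (Suc j)))\<^sup>2 / (norm (r j))\<^sup>2"

lemma cg_0: "x 0 = 0" "r 0 = b" "p 0 = b"
  by (simp_all add: cg_iterate_def cg_residual_def p_def)

lemma cg_Suc:
  "x (Suc j) = x j + a j *\<^sub>R p j"
  "r (Suc j) = r j - a j *\<^sub>R A (p j)"
  "p (Suc j) = r (Suc j) + c j *\<^sub>R p j"
  by (simp_all add: cg_iterate_def cg_residual_def p_def a_def c_def Let_def split_beta)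

lemma energy_nonneg: "0 \<le> A v \<bullet> v"
  using coercive[of v] zero_le_power2[of "norm v"] by linarith

lemma a_nonneg: "0 \<le> a j"
  unfolding a_def using energy_nonneg by simp

text \<open>Division-free form of beta_j. If the residual vanishes, the step length is 0 and the
  next residual vanishes too.\<close>

lemma c_mult: "c j * (norm (r j))\<^sup>2 = (norm (r (Suc j)))\<^sup>2"
proof (cases "r j = 0")
  case True
  then have "a j = 0" by (simp add: a_def)
  with True show ?thesis by (simp add: cg_Suc)
qed (simp add: c_def)

text \<open>Conditional because the induction for \<open>residual_direction\<close> uses it at the
  current index; for \<open>p j = 0\<close> the premise forces a zero residual.\<close>

lemma a_mult_aux: "r j \<bullet> p j = (norm (r j))\<^sup>2 \<Longrightarrow> a j * (A (p j) \<bullet> p j) = (norm (r j))\<^sup>2"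
proof (cases "p j = 0")
  case False
  then have "A (p j) \<bullet> p j \<noteq> 0" using coercive[of "p j"] by auto
  then show ?thesis by (simp add: a_def)
qed auto

text \<open>The step length makes the new residual orthogonal to the old direction, so only the
  residual part of the new direction contributes.\<close>

lemma residual_direction: "r j \<bullet> p j = (norm (r j))\<^sup>2"
proof (induction j)
  case (Suc j)
  have "r (Suc j) \<bullet> p j = 0"
    using Suc a_mult_aux[OF Suc] by (simp add: cg_Suc inner_diff_left)
  then show ?case
    by (simp add: cg_Suc(3) inner_add_right power2_norm_eq_inner)
qed (simp add: cg_0 power2_norm_eq_inner)

lemma a_mult: "a j * (A (p j) \<bullet> p j) = (norm (r j))\<^sup>2"
  by (rule a_mult_aux[OF residual_direction])

text \<open>A zero step length occurs only after exact convergence; this permits cancelling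
  \<open>a i\<close> in the conjugacy proof.\<close>

lemma direction_eq_0:
  assumes "a j = 0"
  shows "p j = 0"
proof -
  have r: "r j = 0" using a_mult[of j] assms by simp
  show ?thesis
  proof (cases j)
    case (Suc i)
    with r have "c i = 0" by (simp add: c_def)
    with r Suc show ?thesis by (simp add: cg_Suc(3))
  next
    case 0
    with r show ?thesis using cg_0 by metis
  qed
qed

text \<open>The two orthogonality relations depend on each other and go through one
  induction.\<close>

lemma conjugacy: "i < j \<Longrightarrow> r j \<bullet> p i = 0 \<and> A (p j) \<bullet> p i = 0"
proof (induction j arbitrary: i)
  case (Suc j)
  have rp: "r (Suc j) \<bullet> p i = 0" if "i \<le> j" for i
  proof (cases "i = j")
    case True
    then show ?thesis
      using residual_direction[of j] a_mult[of j] by (simp add: cg_Suc(2) inner_diff_left)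
  next
    case False
    with that have "i < j" by simp
    then show ?thesis using Suc.IH[of i] by (simp add: cg_Suc(2) inner_diff_left)
  qed
  \<comment> \<open>Each residual is a combination of the directions \<open>p i\<close> and
    \<open>p (i - 1)\<close>, hence covered by \<open>rp\<close>.\<close>
  have rr: "r (Suc j) \<bullet> r i = 0" if "i \<le> j" for i
  proof (cases i)
    case 0
    then show ?thesis using rp[of 0] by (simp add: cg_0)
  next
    case (Suc k)
    then have "r i = p i - c k *\<^sub>R p k" by (simp add: cg_Suc(3))
    then show ?thesis using rp[of i] rp[of k] that Suc by (simp add: inner_diff_right)
  qed
  have "A (p (Suc j)) \<bullet> p i = 0"
  proof (cases "a i = 0")
    case True
    then show ?thesis by (simp add: direction_eq_0)
  next
    case False
    \<comment> \<open>Scaled by \<open>a i\<close>, the vector \<open>A (p i)\<close> becomes a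
      difference of residuals, to which \<open>rr\<close> applies.\<close>
    have Ap: "a i *\<^sub>R A (p i) = r i - r (Suc i)" by (simp add: cg_Suc(2))
    have "A (p (Suc j)) \<bullet> p i = r (Suc j) \<bullet> A (p i) + c j * (A (p j) \<bullet> p i)"
      by (simp add: cg_Suc(3) blinfun.add_right blinfun.scaleR_right inner_add_left sym)
    then have "a i * (A (p (Suc j)) \<bullet> p i) = r (Suc j) \<bullet> (a i *\<^sub>R A (p i)) + c j * (a i * (A (p j) \<bullet> p i))"
      by (simp add: algebra_simps)
    \<comment> \<open>For \<open>i = j\<close> beta_j is chosen for cancellation: the terms are
      minus and plus the squared norm of \<open>r (Suc j)\<close>. For \<open>i < j\<close> both
      vanish separately.\<close>
    also have "\<dots> = 0"
    proof (cases "i = j")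
      case True
      then show ?thesis
        unfolding Ap using a_mult[of j] c_mult[of j] rr[of j]
        by (simp add: inner_diff_right power2_norm_eq_inner)
    next
      case False
      with Suc.prems have "i < j" by simp
      then show ?thesis
        unfolding Ap using Suc.IH[of i] rr[of i] rr[of "Suc i"]
        by (simp add: inner_diff_right)
    qed
    finally show ?thesis using False by simp
  qed
  with rp[of i] Suc.prems show ?case by simp
qed simp

text \<open>The iterate starts at 0 and lies in the span of the earlier directions.\<close>

lemma orthogonal_iterate: "(\<And>i. i < j \<Longrightarrow> v \<bullet> p i = 0) \<Longrightarrow> v \<bullet> x j = 0"
  by (induction j) (simp_all add: cg_0 cg_Suc(1) inner_add_right)

lemma residual_eq: "r j = b - A (x j)"
  by (induction j)
    (simp_all add: cg_0 cg_Suc(1,2) blinfun.add_right blinfun.scaleR_right)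

text \<open>Galerkin identity: the residual is orthogonal to the iterate.\<close>

lemma iterate_energy: "b \<bullet> x j = A (x j) \<bullet> x j"
proof -
  have "r j \<bullet> x j = 0" by (rule orthogonal_iterate) (simp add: conjugacy)
  then show ?thesis by (simp add: residual_eq inner_diff_left)
qed

text \<open>\<open>b\<close> is the residual plus \<open>A (x j)\<close>, and the latter is
  orthogonal to \<open>p j\<close> by conjugacy and symmetry. Hence each CG step raises
  \<open>b \<bullet> x j\<close> by \<open>a j * (norm (r j))\<^sup>2\<close>.\<close>

lemma rhs_direction: "b \<bullet> p j = (norm (r j))\<^sup>2"
proof -
  have "A (p j) \<bullet> x j = 0" by (rule orthogonal_iterate) (simp add: conjugacy)
  then have "A (x j) \<bullet> p j = 0" using sym by (metis inner_commute)
  then show ?thesis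
    using residual_direction[of j] by (simp add: residual_eq inner_diff_left)
qed

lemma norm_iterate: "(norm (x j))\<^sup>2 \<le> b \<bullet> x j"
  using coercive[of "x j"] by (simp add: iterate_energy)

lemma rhs_iterate_mono: "mono (\<lambda>j. b \<bullet> x j)"
  unfolding mono_iff_le_Suc
  by (simp add: cg_Suc(1) inner_add_right rhs_direction a_nonneg)

lemma rhs_iterate_ge:
  assumes "j > 0" "b \<noteq> 0"
  shows "(norm b)\<^sup>2 \<le> norm A * (b \<bullet> x j)"
proof -
  have pos: "A b \<bullet> b > 0"
    using coercive[of b] assms(2) by (smt (verit) zero_less_power zero_less_norm_iff)
  have "A b \<bullet> b \<le> norm A * (norm b)\<^sup>2"
    using norm_cauchy_schwarz[of "A b" b] norm_blinfun[of A b]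
      mult_right_mono[of "norm (A b)" "norm A * norm b" "norm b"]
    by (simp add: power2_eq_square)
  moreover have one: "b \<bullet> x 1 = (norm b)\<^sup>2 * (norm b)\<^sup>2 / (A b \<bullet> b)"
    by (simp add: cg_Suc(1) cg_0 a_def power2_norm_eq_inner)
  \<comment> \<open>Multiplied through by the positive energy of \<open>b\<close>, whose product
    with \<open>b \<bullet> x 1\<close> is the fourth power of the norm of \<open>b\<close>.\<close>
  ultimately have "(A b \<bullet> b) * (norm b)\<^sup>2 \<le> (A b \<bullet> b) * (norm A * (b \<bullet> x 1))"
    using pos mult_right_mono[of "A b \<bullet> b" "norm A * (norm b)\<^sup>2" "(norm b)\<^sup>2"]
    by (simp add: algebra_simps)
  then have "(norm b)\<^sup>2 \<le> norm A * (b \<bullet> x 1)" using pos by simp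
  also have "\<dots> \<le> norm A * (b \<bullet> x j)"
    using monoD[OF rhs_iterate_mono, of 1 j] assms(1) by (intro mult_left_mono) auto
  finally show ?thesis .
qed

end

section \<open>Gradients of second-order semismooth functions\<close>

text \<open>\<open>grad\<close> is a definite description, so uniqueness is required: two gradients
  agree when tested against their difference.\<close>

lemma grad_eqI: "GDERIV f x :> D \<Longrightarrow> grad f x = D"
  unfolding grad_def
proof (rule the_equality)
  fix E assume "GDERIV f x :> D" "GDERIV f x :> E"
  then have "(\<lambda>h. h \<bullet> E) = (\<lambda>h. h \<bullet> D)"
    unfolding gderiv_def by (rule has_derivative_unique[rotated])
  then have "(E - D) \<bullet> E = (E - D) \<bullet> D" by metis
  then have "(E - D) \<bullet> (E - D) = 0" by (simp add: inner_diff_right)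
  then show "E = D" by simp
qed

lemma GDERIV_grad:
  assumes "continuously_differentiable f"
  shows "GDERIV f x :> grad f x"
  using assms grad_eqI[of f x] unfolding continuously_differentiable_def by metis

text \<open>Selecting one operator per increment turns the supremum in ereal into a real inequality;
  the value \<open>h = 0\<close>, outside the punctured neighbourhood, is added trivially.\<close>

lemma second_order_semismooth_grad_expansion:
  assumes "second_order_semismooth T D" "\<epsilon> > 0"
  obtains \<delta> where "\<delta> > 0"
    "\<And>h. norm h < \<delta> \<Longrightarrow> \<exists>M\<in>D (y + h). norm (grad T (y + h) - grad T y - M h) \<le> \<epsilon> * norm h"
proof -
  have ne: "D u \<noteq> {}" for u using assms(1) unfolding second_order_semismooth_def by blast
  have "\<forall>\<^sub>F h in at 0. (SUP M\<in>D (y + h).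
          ereal (norm (grad T (y + h) - grad T y - blinfun_apply M h))) \<le> ereal (\<epsilon> * norm h)"
    using assms unfolding second_order_semismooth_def by blast
  then obtain \<delta> where \<delta>: "\<delta> > 0"
    and sup: "\<And>h. h \<noteq> 0 \<Longrightarrow> norm h < \<delta> \<Longrightarrow> (SUP M\<in>D (y + h).
          ereal (norm (grad T (y + h) - grad T y - blinfun_apply M h))) \<le> ereal (\<epsilon> * norm h)"
    unfolding eventually_at by auto
  have "\<exists>M\<in>D (y + h). norm (grad T (y + h) - grad T y - M h) \<le> \<epsilon> * norm h"
    if "norm h < \<delta>" for h
  proof -
    obtain M where M: "M \<in> D (y + h)" using ne by blast
    have "norm (grad T (y + h) - grad T y - M h) \<le> \<epsilon> * norm h"
    proof (cases "h = 0")
      case False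
      then show ?thesis using sup[OF False that] M by (auto simp: SUP_le_iff)
    qed (simp add: blinfun.zero_right)
    with M show ?thesis by blast
  qed
  with \<delta> that show ?thesis by blast
qed

text \<open>Near each point of the segment the expansion bounds difference quotients by
  \<open>c + \<epsilon>\<close>. These bounds add up over subintervals, and \<epsilon> is
  arbitrary.\<close>

lemma second_order_semismooth_grad_lipschitz:
  assumes "second_order_semismooth T D" and c: "\<And>y M. M \<in> D y \<Longrightarrow> norm M \<le> c"
  shows "norm (grad T y - grad T x) \<le> c * norm (y - x)"
proof (rule field_le_epsilon)
  fix e :: real assume "e > 0"
  define v where "v = y - x"
  define \<epsilon> where "\<epsilon> = e / (norm v + 1)"
  have nv: "norm v + 1 > 0" by (simp add: add_nonneg_pos)
  have "\<epsilon> > 0" unfolding \<epsilon>_def using \<open>e > 0\<close> nv by simp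
  let ?G = "\<lambda>t. grad T (x + t *\<^sub>R v)"
  \<comment> \<open>The expansion holds only near each point with a radius depending on it; bisection makes it global.\<close>
  have "norm (?G 1 - ?G 0) \<le> (c + \<epsilon>) * norm v * (1 - 0)"
  proof (rule Bolzano[of 0 1 "\<lambda>s t. norm (?G t - ?G s) \<le> (c + \<epsilon>) * norm v * (t - s)"])
    fix s t u :: real
    assume "norm (?G t - ?G s) \<le> (c + \<epsilon>) * norm v * (t - s)"
      and "norm (?G u - ?G t) \<le> (c + \<epsilon>) * norm v * (u - t)"
    moreover have "norm (?G u - ?G s) \<le> norm (?G u - ?G t) + norm (?G t - ?G s)"
      using norm_triangle_ineq[of "?G u - ?G t" "?G t - ?G s"] by simp
    ultimately show "norm (?G u - ?G s) \<le> (c + \<epsilon>) * norm v * (u - s)"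
      by (simp add: algebra_simps)
  next
    fix s :: real
    obtain \<delta> where "\<delta> > 0" and \<delta>: "\<And>h. norm h < \<delta> \<Longrightarrow> \<exists>M\<in>D (x + s *\<^sub>R v + h).
        norm (grad T (x + s *\<^sub>R v + h) - grad T (x + s *\<^sub>R v) - M h) \<le> \<epsilon> * norm h"
      using second_order_semismooth_grad_expansion[OF assms(1) \<open>\<epsilon> > 0\<close>] by blast
    have loc: "norm (?G t - ?G s) \<le> (c + \<epsilon>) * norm v * \<bar>t - s\<bar>"
      if "\<bar>t - s\<bar> < \<delta> / (norm v + 1)" for t
    proof -
      let ?h = "(t - s) *\<^sub>R v"
      have "norm ?h \<le> \<bar>t - s\<bar> * (norm v + 1)" by (simp add: mult_left_mono)
      also have "\<dots> < \<delta>" using that nv by (simp add: field_simps)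
      finally obtain M where M: "M \<in> D (x + s *\<^sub>R v + ?h)"
        "norm (grad T (x + s *\<^sub>R v + ?h) - grad T (x + s *\<^sub>R v) - M ?h) \<le> \<epsilon> * norm ?h"
        using \<delta> by blast
      have "norm (M ?h) \<le> c * norm ?h"
        using norm_blinfun[of M ?h] mult_right_mono[OF c[OF M(1)], of "norm ?h"] by simp
      moreover have "norm (?G t - ?G s) \<le> norm (?G t - ?G s - M ?h) + norm (M ?h)"
        by (metis diff_add_cancel norm_triangle_ineq)
      moreover have "x + s *\<^sub>R v + ?h = x + t *\<^sub>R v" by (simp add: algebra_simps)
      ultimately have "norm (?G t - ?G s) \<le> (c + \<epsilon>) * norm ?h"
        using M(2) unfolding distrib_right add.assoc by simp
      then show ?thesis unfolding norm_scaleR by (simp add: mult_ac)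
    qed
    \<comment> \<open>The expansion is based at \<open>s\<close> only, so a short interval around
      \<open>s\<close> is split there.\<close>
    show "\<exists>d>0. \<forall>t u. t \<le> s \<and> s \<le> u \<and> u - t < d \<longrightarrow>
        norm (?G u - ?G t) \<le> (c + \<epsilon>) * norm v * (u - t)"
    proof (intro exI[of _ "\<delta> / (norm v + 1)"] conjI allI impI)
      fix t u assume *: "t \<le> s \<and> s \<le> u \<and> u - t < \<delta> / (norm v + 1)"
      have "norm (?G u - ?G t) \<le> norm (?G u - ?G s) + norm (?G t - ?G s)"
        using norm_triangle_ineq4[of "?G u - ?G s" "?G t - ?G s"] by simp
      moreover have "norm (?G u - ?G s) \<le> (c + \<epsilon>) * norm v * \<bar>u - s\<bar>"
        "norm (?G t - ?G s) \<le> (c + \<epsilon>) * norm v * \<bar>t - s\<bar>"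
        using * by (intro loc; linarith)+
      moreover have "\<bar>u - s\<bar> = u - s" "\<bar>t - s\<bar> = s - t" using * by auto
      ultimately show "norm (?G u - ?G t) \<le> (c + \<epsilon>) * norm v * (u - t)"
        by (simp add: algebra_simps)
    qed (use \<open>\<delta> > 0\<close> nv in simp)
  qed simp
  then have "norm (grad T y - grad T x) \<le> c * norm (y - x) + \<epsilon> * norm v"
    by (simp add: v_def algebra_simps)
  moreover have "\<epsilon> * norm v \<le> e"
    unfolding \<epsilon>_def using \<open>e > 0\<close> nv by (simp add: field_simps)
  ultimately show "norm (grad T y - grad T x) \<le> c * norm (y - x) + e" by linarith
qed

text \<open>Same bisection as for the Lipschitz bound, now with a lower bound: the quadratic form of
  the operator is nonnegative and the remainder costs at most an \<epsilon> term.\<close>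

lemma second_order_semismooth_grad_monotone:
  assumes "second_order_semismooth T D"
    and psd: "\<And>y M h. M \<in> D y \<Longrightarrow> 0 \<le> blinfun_apply M h \<bullet> h"
  shows "0 \<le> (grad T y - grad T x) \<bullet> (y - x)"
proof (rule field_le_epsilon)
  fix e :: real assume "e > 0"
  define v where "v = y - x"
  define N where "N = (norm v)\<^sup>2 + 1"
  have N: "N > 0" unfolding N_def by (simp add: add_nonneg_pos)
  have nv: "norm v + 1 > 0" by (simp add: add_nonneg_pos)
  define \<epsilon> where "\<epsilon> = e / N"
  have "\<epsilon> > 0" unfolding \<epsilon>_def using \<open>e > 0\<close> N by simp
  let ?G = "\<lambda>t. grad T (x + t *\<^sub>R v)"
  have "- \<epsilon> * (norm v)\<^sup>2 * (1 - 0) \<le> (?G 1 - ?G 0) \<bullet> v"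
  proof (rule Bolzano[of 0 1 "\<lambda>s t. - \<epsilon> * (norm v)\<^sup>2 * (t - s) \<le> (?G t - ?G s) \<bullet> v"])
    fix s t u :: real
    assume "- \<epsilon> * (norm v)\<^sup>2 * (t - s) \<le> (?G t - ?G s) \<bullet> v"
      and "- \<epsilon> * (norm v)\<^sup>2 * (u - t) \<le> (?G u - ?G t) \<bullet> v"
    then show "- \<epsilon> * (norm v)\<^sup>2 * (u - s) \<le> (?G u - ?G s) \<bullet> v"
      by (simp add: algebra_simps)
  next
    fix s :: real
    obtain \<delta> where "\<delta> > 0" and \<delta>: "\<And>h. norm h < \<delta> \<Longrightarrow> \<exists>M\<in>D (x + s *\<^sub>R v + h).
        norm (grad T (x + s *\<^sub>R v + h) - grad T (x + s *\<^sub>R v) - M h) \<le> \<epsilon> * norm h"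
      using second_order_semismooth_grad_expansion[OF assms(1) \<open>\<epsilon> > 0\<close>] by blast
    \<comment> \<open>The factor \<open>t - s\<close> is kept on the right so that both sides of
      \<open>s\<close> are treated at once.\<close>
    have loc: "- \<epsilon> * (norm v)\<^sup>2 * (t - s)\<^sup>2 \<le> (t - s) * ((?G t - ?G s) \<bullet> v)"
      if "\<bar>t - s\<bar> < \<delta> / (norm v + 1)" for t
    proof -
      let ?h = "(t - s) *\<^sub>R v"
      have "norm ?h \<le> \<bar>t - s\<bar> * (norm v + 1)" by (simp add: mult_left_mono)
      also have "\<dots> < \<delta>" using that nv by (simp add: field_simps)
      finally obtain M where M: "M \<in> D (x + s *\<^sub>R v + ?h)"
        "norm (grad T (x + s *\<^sub>R v + ?h) - grad T (x + s *\<^sub>R v) - M ?h) \<le> \<epsilon> * norm ?h"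
        using \<delta> by blast
      define w where "w = ?G t - ?G s - M ?h"
      have "norm w \<le> \<epsilon> * norm ?h" unfolding w_def using M(2) by (simp add: algebra_simps)
      then have "\<bar>w \<bullet> ?h\<bar> \<le> \<epsilon> * norm ?h * norm ?h"
        using Cauchy_Schwarz_ineq2[of w ?h] mult_right_mono[of "norm w" _ "norm ?h"]
        by (meson norm_ge_zero order_trans)
      also have "\<dots> = \<epsilon> * (norm v)\<^sup>2 * (t - s)\<^sup>2"
        using power_mult_distrib[of "\<bar>t - s\<bar>" "norm v" 2]
        by (simp only: norm_scaleR mult.assoc power2_abs mult.commute[of "(norm v)\<^sup>2"]
            flip: power2_eq_square)
      finally have "- \<epsilon> * (norm v)\<^sup>2 * (t - s)\<^sup>2 \<le> w \<bullet> ?h + M ?h \<bullet> ?h"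
        using psd[OF M(1), of ?h] by simp
      also have "\<dots> = (w + M ?h) \<bullet> ?h" by (simp only: inner_add_left)
      also have "\<dots> = (t - s) * ((?G t - ?G s) \<bullet> v)" by (simp add: w_def)
      finally show ?thesis .
    qed
    \<comment> \<open>Division by the distance to \<open>s\<close> leaves a sign, which orients the
      difference correctly on either side.\<close>
    have div: "- \<epsilon> * (norm v)\<^sup>2 * \<bar>t - s\<bar> \<le> sgn (t - s) * ((?G t - ?G s) \<bullet> v)"
      if "\<bar>t - s\<bar> < \<delta> / (norm v + 1)" for t
    proof (cases "t = s")
      case False
      have "\<bar>t - s\<bar> * (- \<epsilon> * (norm v)\<^sup>2 * \<bar>t - s\<bar>) = - \<epsilon> * (norm v)\<^sup>2 * (t - s)\<^sup>2"
        by (simp add: power2_eq_square)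
      also have "\<dots> \<le> (t - s) * ((?G t - ?G s) \<bullet> v)" by (rule loc[OF that])
      also have "\<dots> = \<bar>t - s\<bar> * (sgn (t - s) * ((?G t - ?G s) \<bullet> v))"
        by (simp only: mult.assoc[symmetric] abs_mult_sgn)
      finally show ?thesis
        using False by (simp only: mult_le_cancel_left_pos zero_less_abs_iff right_minus_eq not_False_eq_True)
    qed simp
    show "\<exists>d>0. \<forall>t u. t \<le> s \<and> s \<le> u \<and> u - t < d \<longrightarrow>
        - \<epsilon> * (norm v)\<^sup>2 * (u - t) \<le> (?G u - ?G t) \<bullet> v"
    proof (intro exI[of _ "\<delta> / (norm v + 1)"] conjI allI impI)
      fix t u assume *: "t \<le> s \<and> s \<le> u \<and> u - t < \<delta> / (norm v + 1)"
      have "- \<epsilon> * (norm v)\<^sup>2 * (u - s) \<le> (?G u - ?G s) \<bullet> v"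
        using div[of u] * by (cases "u = s") auto
      moreover have "- \<epsilon> * (norm v)\<^sup>2 * (s - t) \<le> (?G s - ?G t) \<bullet> v"
        using div[of t] * by (cases "t = s") (auto simp: inner_diff_left)
      ultimately show "- \<epsilon> * (norm v)\<^sup>2 * (u - t) \<le> (?G u - ?G t) \<bullet> v"
        by (simp add: algebra_simps)
    qed (use \<open>\<delta> > 0\<close> nv in simp)
  qed simp
  then have "0 \<le> (grad T y - grad T x) \<bullet> (y - x) + \<epsilon> * (norm v)\<^sup>2"
    by (simp add: v_def algebra_simps)
  moreover have "\<epsilon> * (norm v)\<^sup>2 \<le> \<epsilon> * N" unfolding N_def using \<open>\<epsilon> > 0\<close> by simp
  moreover have "\<epsilon> * N = e" unfolding \<epsilon>_def using N by simp
  ultimately show "0 \<le> (grad T y - grad T x) \<bullet> (y - x) + e" by linarith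
qed

section \<open>Descent methods with Armijo line search\<close>

text \<open>Subtracting the claimed parabola from \<open>F\<close> along the segment leaves a
  function with nonpositive derivative. \<open>K\<close> may be negative, so the argument also
  serves \<open>- F\<close> under strong monotonicity.\<close>

lemma GDERIV_quadratic_upper:
  assumes "\<And>y. GDERIV F y :> G y"
    and "\<And>t. 0 \<le> t \<Longrightarrow> t \<le> 1 \<Longrightarrow> (G (x + t *\<^sub>R h) - G x) \<bullet> h \<le> K * t"
  shows "F (x + h) \<le> F x + G x \<bullet> h + K / 2"
proof -
  define \<phi> where "\<phi> t = F (x + t *\<^sub>R h) - t * (G x \<bullet> h) - K / 2 * t\<^sup>2" for t
  have "\<phi> 1 \<le> \<phi> 0"
  proof (rule DERIV_nonpos_imp_nonincreasing[of 0 1 \<phi>])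
    fix t :: real assume t: "0 \<le> t" "t \<le> 1"
    have "((\<lambda>t. F (x + t *\<^sub>R h)) has_derivative (\<lambda>s. (s *\<^sub>R h) \<bullet> G (x + t *\<^sub>R h))) (at t)"
      by (rule has_derivative_compose[of "\<lambda>t. x + t *\<^sub>R h"])
        (use assms(1)[unfolded gderiv_def] in \<open>auto intro!: derivative_eq_intros\<close>)
    then have "((\<lambda>t. F (x + t *\<^sub>R h)) has_real_derivative G (x + t *\<^sub>R h) \<bullet> h) (at t)"
      by (simp add: has_field_derivative_def inner_commute mult_commute_abs)
    then have "(\<phi> has_real_derivative (G (x + t *\<^sub>R h) \<bullet> h - G x \<bullet> h - K * t)) (at t)"
      unfolding \<phi>_def by (auto intro!: derivative_eq_intros)
    then show "\<exists>y. (\<phi> has_real_derivative y) (at t) \<and> y \<le> 0"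
      using assms(2)[OF t] by (auto simp: inner_diff_left)
  qed simp
  then show ?thesis by (simp add: \<phi>_def)
qed

lemma descent_lemma:
  assumes "\<And>y. GDERIV F y :> G y" and "\<And>x y. norm (G y - G x) \<le> L * norm (y - x)"
  shows "F (x + h) \<le> F x + G x \<bullet> h + L / 2 * (norm h)\<^sup>2"
proof -
  have "(G (x + t *\<^sub>R h) - G x) \<bullet> h \<le> L * (norm h)\<^sup>2 * t" if "0 \<le> t" for t
  proof -
    have "(G (x + t *\<^sub>R h) - G x) \<bullet> h \<le> norm (G (x + t *\<^sub>R h) - G x) * norm h"
      by (rule norm_cauchy_schwarz)
    also have "\<dots> \<le> L * norm (x + t *\<^sub>R h - x) * norm h"
      by (intro mult_right_mono assms) simp
    finally show ?thesis using that by (simp add: power2_eq_square algebra_simps)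
  qed
  then show ?thesis
    using GDERIV_quadratic_upper[OF assms(1), of x h "L * (norm h)\<^sup>2"] by simp
qed

text \<open>Strong monotonicity gives a quadratic lower model at \<open>x\<close>; its minimum over
  all increments, attained at \<open>- G x\<close>, bounds \<open>F\<close> below.\<close>

lemma strongly_monotone_gradient_lower:
  assumes "\<And>y. GDERIV F y :> G y" and "\<And>x y. (norm (y - x))\<^sup>2 \<le> (G y - G x) \<bullet> (y - x)"
  shows "F x - (norm (G x))\<^sup>2 / 2 \<le> F y"
proof -
  have "((\<lambda>u. - G u) (x + t *\<^sub>R h) - (\<lambda>u. - G u) x) \<bullet> h \<le> - (norm h)\<^sup>2 * t" if "0 \<le> t" for t h
  proof (cases "t = 0")
    case False
    with that have "t > 0" by simp
    have "t * (t * (norm h)\<^sup>2) \<le> t * ((G (x + t *\<^sub>R h) - G x) \<bullet> h)"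
      using assms(2)[of "x + t *\<^sub>R h" x] by (simp add: power2_eq_square algebra_simps)
    with \<open>t > 0\<close> have "t * (norm h)\<^sup>2 \<le> (G (x + t *\<^sub>R h) - G x) \<bullet> h"
      by (simp only: mult_le_cancel_left_pos)
    then show ?thesis by (simp add: algebra_simps)
  qed simp
  moreover have "GDERIV (\<lambda>u. - F u) u :> - G u" for u
    using has_derivative_minus[OF assms(1)[of u, unfolded gderiv_def]] by (simp add: gderiv_def)
  ultimately have *: "F x + G x \<bullet> h + (norm h)\<^sup>2 / 2 \<le> F (x + h)" for h
    using GDERIV_quadratic_upper[of "\<lambda>u. - F u" "\<lambda>u. - G u" x h "- (norm h)\<^sup>2"] by fastforce
  have "0 \<le> (norm (G x + h))\<^sup>2" for h by simp
  then have "- (norm (G x))\<^sup>2 / 2 \<le> G x \<bullet> h + (norm h)\<^sup>2 / 2" for h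
    by (simp add: power2_norm_eq_inner inner_add inner_commute field_simps)
      (smt (verit, best))
  then show ?thesis using *[of "y - x"] by (smt (verit, best) add.commute diff_add_cancel minus_divide_left)
qed

text \<open>Cauchy-Schwarz, divided by the distance. It transfers convergence of gradients to the
  points and gives uniqueness of the zero.\<close>

lemma strongly_monotone_expansive:
  assumes "(norm (y - x))\<^sup>2 \<le> (u - v) \<bullet> (y - x)"
  shows "norm (y - x) \<le> norm (u - v)"
proof (cases "y = x")
  case False
  have "norm (y - x) * norm (y - x) \<le> norm (u - v) * norm (y - x)"
    using assms norm_cauchy_schwarz[of "u - v" "y - x"] by (simp add: power2_eq_square)
  then show ?thesis using False by simp
qed simp

text \<open>The Newton method enters only through \<open>dir\<close> and \<open>angle\<close>. The
  zero of the gradient is not presupposed: it arises as the limit of the iterates.\<close>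

lemma armijo_descent_converges:
  fixes F :: "'a::{real_inner, complete_space} \<Rightarrow> real"
  assumes deriv: "\<And>y. GDERIV F y :> grad F y"
    and lip: "\<And>x y. norm (grad F y - grad F x) \<le> L * norm (y - x)"
    and mono: "\<And>x y. (norm (y - x))\<^sup>2 \<le> (grad F y - grad F x) \<bullet> (y - x)"
    and dir: "\<And>k. (norm (d k))\<^sup>2 \<le> - (d k \<bullet> grad F (\<xi> k))"
    and angle: "\<And>k. (norm (grad F (\<xi> k)))\<^sup>2 \<le> C * - (d k \<bullet> grad F (\<xi> k))"
    and "0 < \<sigma>" "\<sigma> < 1" "0 < \<beta>" "\<beta> < 1"
    and step: "\<And>k. armijo F \<sigma> \<beta> (\<xi> k) (d k) (l k)"
      "\<And>k i. i < l k \<Longrightarrow> \<not> armijo F \<sigma> \<beta> (\<xi> k) (d k) i"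
      "\<And>k. \<xi> (Suc k) = \<xi> k + \<beta> ^ l k *\<^sub>R d k"
  shows "\<exists>\<xi>b. grad F \<xi>b = 0 \<and> (\<forall>\<zeta>. grad F \<zeta> = 0 \<longrightarrow> \<zeta> = \<xi>b) \<and> \<xi> \<longlonglongrightarrow> \<xi>b \<and> d \<longlonglongrightarrow> 0"
proof -
  define s where "s k = - (d k \<bullet> grad F (\<xi> k))" for k
  have s0: "0 \<le> s k" for k
    using dir[of k] zero_le_power2[of "norm (d k)"] unfolding s_def by linarith
  define K where "K = \<bar>L\<bar> + 1"
  have K: "K > 0" "L \<le> K" unfolding K_def by auto
  \<comment> \<open>A rejected step length exceeds \<open>2 * (1 - \<sigma>) / K\<close>, and the
    accepted one is \<beta> times the last rejected one; the 1 covers immediate acceptance.\<close>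
  define m where "m = min 1 (\<beta> * (2 * (1 - \<sigma>) / K))"
  have "m > 0" unfolding m_def using assms K by simp
  have steplen: "m \<le> \<beta> ^ l k" for k
  proof (cases "l k")
    case 0
    then show ?thesis by (simp add: m_def)
  next
    case (Suc i)
    define t where "t = \<beta> ^ i"
    have "t > 0" unfolding t_def using assms by simp
    have "\<not> armijo F \<sigma> \<beta> (\<xi> k) (d k) i" using step(2) Suc by simp
    \<comment> \<open>The failed Armijo test at exponent \<open>l k - 1\<close> is played against
      the descent lemma; \<open>dir\<close> then replaces the squared norm of \<open>d k\<close> by
      \<open>s k\<close>.\<close>
    then have "- (\<sigma> * t * s k) < F (\<xi> k + t *\<^sub>R d k) - F (\<xi> k)"
      unfolding armijo_def s_def t_def by simp
    also have "\<dots> \<le> - (t * s k) + L / 2 * (t\<^sup>2 * (norm (d k))\<^sup>2)"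
      using descent_lemma[OF deriv lip, of "\<xi> k" "t *\<^sub>R d k"]
      by (simp add: s_def inner_commute power_mult_distrib)
    also have "\<dots> \<le> - (t * s k) + K / 2 * (t\<^sup>2 * s k)"
      using dir[of k] K s0[of k] unfolding s_def by (intro add_left_mono mult_mono) auto
    finally have "0 < t * s k * (K / 2 * t - (1 - \<sigma>))"
      by (simp add: algebra_simps power2_eq_square)
    moreover have "0 \<le> t * s k" using \<open>t > 0\<close> s0 by simp
    ultimately have "1 - \<sigma> < K / 2 * t" by (simp add: zero_less_mult_iff)
    then have "2 * (1 - \<sigma>) / K \<le> t" using K by (simp add: field_simps)
    then have "\<beta> * (2 * (1 - \<sigma>) / K) \<le> \<beta> ^ l k"
      using assms unfolding Suc t_def power_Suc by (intro mult_left_mono) auto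
    then show ?thesis unfolding m_def by linarith
  qed
  have decr: "\<sigma> * m * s k \<le> F (\<xi> k) - F (\<xi> (Suc k))" for k
  proof -
    have "\<sigma> * m * s k \<le> \<sigma> * \<beta> ^ l k * s k"
      using steplen s0 assms by (intro mult_right_mono mult_left_mono) auto
    also have "\<dots> \<le> F (\<xi> k) - F (\<xi> (Suc k))"
      using step(1)[of k] unfolding armijo_def step(3) s_def by simp
    finally show ?thesis .
  qed
  have "decseq (\<lambda>k. F (\<xi> k))"
  proof (rule decseq_SucI)
    fix k
    have "0 \<le> \<sigma> * m * s k" using assms \<open>m > 0\<close> s0 by simp
    with decr[of k] show "F (\<xi> (Suc k)) \<le> F (\<xi> k)" by linarith
  qed
  then obtain B where B: "(\<lambda>k. F (\<xi> k)) \<longlonglongrightarrow> B"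
    using decseq_convergent strongly_monotone_gradient_lower[OF deriv mono, of 0] by metis
  \<comment> \<open>The decreasing values are bounded below and converge, so consecutive differences
    tend to 0 and force \<open>s\<close> to 0.\<close>
  have "(\<lambda>k. (F (\<xi> k) - F (\<xi> (Suc k))) / (\<sigma> * m)) \<longlonglongrightarrow> (B - B) / (\<sigma> * m)"
    using assms \<open>m > 0\<close> by (intro tendsto_intros B LIMSEQ_Suc) auto
  then have lim: "(\<lambda>k. (F (\<xi> k) - F (\<xi> (Suc k))) / (\<sigma> * m)) \<longlonglongrightarrow> 0" by simp
  have "s \<longlonglongrightarrow> 0"
  proof (rule tendsto_sandwich[OF _ _ tendsto_const lim])
    show "\<forall>\<^sub>F k in sequentially. s k \<le> (F (\<xi> k) - F (\<xi> (Suc k))) / (\<sigma> * m)"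
      using decr assms \<open>m > 0\<close> by (simp add: field_simps)
  qed (use s0 in simp)
  have null: "X \<longlonglongrightarrow> 0" if "\<And>k. (norm (X k))\<^sup>2 \<le> E * s k" for X :: "nat \<Rightarrow> 'a" and E
  proof -
    have lim: "(\<lambda>k. E * s k) \<longlonglongrightarrow> 0" by (rule tendsto_mult_right_zero[OF \<open>s \<longlonglongrightarrow> 0\<close>])
    have "\<forall>\<^sub>F k in sequentially. norm ((norm (X k))\<^sup>2) \<le> E * s k"
      using that by (intro always_eventually) simp
    then have "(\<lambda>k. (norm (X k))\<^sup>2) \<longlonglongrightarrow> 0" using lim by (rule Lim_null_comparison)
    from tendsto_real_sqrt[OF this] show ?thesis by (simp add: tendsto_norm_zero_iff)
  qed
  have d0: "d \<longlonglongrightarrow> 0" using dir by (intro null[of _ 1]) (simp add: s_def)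
  have g0: "(\<lambda>k. grad F (\<xi> k)) \<longlonglongrightarrow> 0" using angle by (intro null[of _ C]) (simp add: s_def)
  have expansive: "norm (y - x) \<le> norm (grad F y - grad F x)" for x y
    using mono by (rule strongly_monotone_expansive)
  have "Cauchy \<xi>"
  proof (rule metric_CauchyI)
    fix e :: real assume "e > 0"
    have "Cauchy (\<lambda>k. grad F (\<xi> k))" using g0 by (rule LIMSEQ_imp_Cauchy)
    from metric_CauchyD[OF this \<open>e > 0\<close>]
    show "\<exists>M. \<forall>i\<ge>M. \<forall>j\<ge>M. dist (\<xi> i) (\<xi> j) < e"
      unfolding dist_norm by (meson expansive le_less_trans)
  qed
  then obtain \<xi>b where lim: "\<xi> \<longlonglongrightarrow> \<xi>b" using Cauchy_convergent convergent_def by blast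
  \<comment> \<open>The Lipschitz bound gives continuity at the limit, which is therefore a zero of
    the gradient.\<close>
  have "(\<lambda>k. grad F (\<xi> k) - grad F \<xi>b) \<longlonglongrightarrow> 0"
  proof (rule Lim_null_comparison)
    show "\<forall>\<^sub>F k in sequentially. norm (grad F (\<xi> k) - grad F \<xi>b) \<le> L * norm (\<xi> k - \<xi>b)"
      by (simp add: lip)
    have "(\<lambda>k. L * norm (\<xi> k - \<xi>b)) \<longlonglongrightarrow> L * norm (\<xi>b - \<xi>b)" by (intro tendsto_intros lim)
    then show "(\<lambda>k. L * norm (\<xi> k - \<xi>b)) \<longlonglongrightarrow> 0" by simp
  qed
  then have "(\<lambda>k. grad F (\<xi> k)) \<longlonglongrightarrow> grad F \<xi>b" by (rule LIM_zero_cancel)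
  then have "grad F \<xi>b = 0" using g0 by (rule LIMSEQ_unique)
  moreover have "\<zeta> = \<xi>b" if "grad F \<zeta> = 0" for \<zeta>
    using expansive[of \<zeta> \<xi>b] that \<open>grad F \<xi>b = 0\<close> by simp
  ultimately show ?thesis using lim d0 by blast
qed

section \<open>The semismooth Newton method\<close>

lemma GDERIV_Phi:
  assumes "continuously_differentiable (Psi S g \<alpha>)"
  shows "GDERIV (Phi S z g \<alpha>) y :> y - z + grad (Psi S g \<alpha>) y"
proof -
  have "((\<lambda>\<xi>. ((\<xi> - z) \<bullet> (\<xi> - z)) / 2 - (norm z)\<^sup>2 / 2 + Psi S g \<alpha> \<xi>) has_derivative
      (\<lambda>h. h \<bullet> (y - z + grad (Psi S g \<alpha>) y))) (at y)"
    using GDERIV_grad[OF assms, of y] unfolding gderiv_def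
    by (auto intro!: derivative_eq_intros simp: inner_add_right inner_commute)
  then show ?thesis
    unfolding gderiv_def by (simp add: Phi_def[abs_def] power2_norm_eq_inner)
qed

text \<open>The condition \<open>d k \<noteq> 0\<close> excludes stalling: if the tolerance is at
  least the gradient norm, CG returns 0, the line search accepts exponent 0, and the run stays at a
  nonstationary point.\<close>

theorem lemma5p10:
  fixes S :: "'u::{real_inner, complete_space} \<Rightarrow>\<^sub>L 'y::{real_inner, complete_space}"
    and z :: 'y and \<alpha> :: real and g :: "'u \<Rightarrow> ereal"
    and D :: "'y \<Rightarrow> ('y \<Rightarrow>\<^sub>L 'y) set"
    and \<sigma> \<beta> \<eta> \<tau> :: real and \<xi> d :: "nat \<Rightarrow> 'y"
  assumes "\<alpha> > 0"
    and "proper g" and "convex_ereal g" and "lsc g" and "g 0 < \<infinity>"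
    and "\<forall>y. D y \<subseteq> psd_operators"
    and "second_order_semismooth (Psi S g \<alpha>) D"
    and "\<exists>c>0. \<forall>y. \<forall>M\<in>D y. norm M \<le> c"
    and "0 < \<sigma>" and "\<sigma> < 1 / 2" and "0 < \<beta>" and "\<beta> < 1"
    and "0 \<le> \<eta>" and "0 < \<tau>" and "\<tau> \<le> 1"
    and "newton_run (Phi S z g \<alpha>) (hessian_Phi D) \<sigma> \<beta> \<eta> \<tau> \<xi> d"
    and "\<forall>k. d k \<noteq> 0"
  shows "\<exists>\<xi>b. grad (Phi S z g \<alpha>) \<xi>b = 0 \<and>
           (\<forall>\<zeta>. grad (Phi S z g \<alpha>) \<zeta> = 0 \<longrightarrow> \<zeta> = \<xi>b) \<and>
           \<xi> \<longlonglongrightarrow> \<xi>b \<and> d \<longlonglongrightarrow> 0"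
proof -
  let ?T = "Psi S g \<alpha>" and ?F = "Phi S z g \<alpha>"
  obtain c where c: "\<And>y M. M \<in> D y \<Longrightarrow> norm M \<le> c" using assms(8) by blast
  have psd: "0 \<le> blinfun_apply M h \<bullet> h" if "M \<in> D y" for y M h
    using assms(6) that unfolding psd_operators_def by blast
  have deriv: "GDERIV ?F y :> y - z + grad ?T y" for y
    using assms(7) unfolding second_order_semismooth_def by (intro GDERIV_Phi) blast
  then have grad: "grad ?F y = y - z + grad ?T y" for y by (rule grad_eqI)
  have lip: "norm (grad ?F y - grad ?F x) \<le> (1 + c) * norm (y - x)" for x y
    using norm_triangle_ineq[of "y - x" "grad ?T y - grad ?T x"]
      second_order_semismooth_grad_lipschitz[OF assms(7), where x = x and y = y and c = c] c
    by (simp add: grad algebra_simps)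
  have mono: "(norm (y - x))\<^sup>2 \<le> (grad ?F y - grad ?F x) \<bullet> (y - x)" for x y
  proof -
    have "(grad ?F y - grad ?F x) \<bullet> (y - x)
        = (norm (y - x))\<^sup>2 + (grad ?T y - grad ?T x) \<bullet> (y - x)"
      by (simp add: grad power2_norm_eq_inner algebra_simps)
    then show ?thesis
      using second_order_semismooth_grad_monotone[OF assms(7), where x = x and y = y] psd by simp
  qed
  have "\<forall>k. \<exists>M l. M \<in> hessian_Phi D (\<xi> k) \<and>
      cg_returns M (- grad ?F (\<xi> k)) (\<eta> * norm (grad ?F (\<xi> k)) powr (1 + \<tau>)) (d k) \<and>
      armijo ?F \<sigma> \<beta> (\<xi> k) (d k) l \<and> (\<forall>l'<l. \<not> armijo ?F \<sigma> \<beta> (\<xi> k) (d k) l') \<and>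
      \<xi> (Suc k) = \<xi> k + \<beta> ^ l *\<^sub>R d k"
    using assms(16) unfolding newton_run_def by blast
  then obtain M l where run: "\<And>k. M k \<in> hessian_Phi D (\<xi> k)"
    "\<And>k. cg_returns (M k) (- grad ?F (\<xi> k)) (\<eta> * norm (grad ?F (\<xi> k)) powr (1 + \<tau>)) (d k)"
    "\<And>k. armijo ?F \<sigma> \<beta> (\<xi> k) (d k) (l k)"
    "\<And>k i. i < l k \<Longrightarrow> \<not> armijo ?F \<sigma> \<beta> (\<xi> k) (d k) i"
    "\<And>k. \<xi> (Suc k) = \<xi> k + \<beta> ^ l k *\<^sub>R d k"
    by metis
  have directions: "(norm (d k))\<^sup>2 \<le> - (d k \<bullet> grad ?F (\<xi> k)) \<and>
      (norm (grad ?F (\<xi> k)))\<^sup>2 \<le> (1 + c) * - (d k \<bullet> grad ?F (\<xi> k))" for k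
  proof -
    obtain N where N: "N \<in> D (\<xi> k)" "M k = id_blinfun + N"
      using run(1)[of k] unfolding hessian_Phi_def by blast
    \<comment> \<open>The identity summand supplies the coercivity constant 1.\<close>
    interpret cg "M k" "- grad ?F (\<xi> k)"
    proof
      fix x y
      have "N \<in> psd_operators" using assms(6) N(1) by blast
      then show "M k x \<bullet> y = x \<bullet> M k y"
        by (simp add: N(2) blinfun.add_left inner_add psd_operators_symmetric)
      show "(norm x)\<^sup>2 \<le> M k x \<bullet> x"
        using psd[OF N(1), of x]
        by (simp add: N(2) blinfun.add_left inner_add power2_norm_eq_inner)
    qed
    obtain j where j: "d k = cg_iterate (M k) (- grad ?F (\<xi> k)) j"
      using run(2)[of k] unfolding cg_returns_def by blast
    \<comment> \<open>Index 0 would return the zero iterate; with at least one CG step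
      \<open>rhs_iterate_ge\<close> applies.\<close>
    have "j > 0" using assms(17) j cg_0(1) by (cases j) auto
    have nz: "- grad ?F (\<xi> k) \<noteq> 0" using assms(16) unfolding newton_run_def by simp
    have d: "(norm (d k))\<^sup>2 \<le> - (d k \<bullet> grad ?F (\<xi> k))"
      using norm_iterate[of j] by (simp add: j inner_commute)
    have "norm (M k) \<le> 1 + c"
      using norm_triangle_ineq[of id_blinfun N] norm_blinfun_id_le[where 'a='y] c[OF N(1)]
      unfolding N(2) by linarith
    moreover have "0 \<le> - (d k \<bullet> grad ?F (\<xi> k))"
      using d zero_le_power2[of "norm (d k)"] by linarith
    ultimately have "norm (M k) * - (d k \<bullet> grad ?F (\<xi> k)) \<le> (1 + c) * - (d k \<bullet> grad ?F (\<xi> k))"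
      by (rule mult_right_mono)
    moreover have "(norm (grad ?F (\<xi> k)))\<^sup>2 \<le> norm (M k) * - (d k \<bullet> grad ?F (\<xi> k))"
      using rhs_iterate_ge[OF \<open>j > 0\<close> nz] by (simp add: j inner_commute)
    ultimately show ?thesis using d by linarith
  qed
  show ?thesis
  proof (rule armijo_descent_converges[where L = "1 + c" and C = "1 + c" and l = l and \<sigma> = \<sigma> and \<beta> = \<beta>])
    show "GDERIV ?F y :> grad ?F y" for y using deriv by (simp add: grad)
  qed (use lip mono directions run assms in auto)
qed

end
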